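(* Let $p$ and $q$ be binary input registers, $p\in\{0,1\}^{n-1}$ and $q\in\{0,1\}^{m}$ with $m=\lceil n/2\rceil$, and let $C_\times$ be a deterministic Boolean circuit which, on input $(p,q)$, computes the binary product $pq$ on an output register $y\in\{0,1\}^{W}$ of width $W$, where $W$ is large enough to represent every product $pq$ in full. Replace each gate of $C_\times$ by its indicator tensor and contract all internal wire indices, obtaining a tensor $T(p,q,y)$ whose free indices are the bits of $p$, $q$ and $y$. Then, for all $p\in\{0,1\}^{n-1}$, $q\in\{0,1\}^{m}$ and $y\in\{0,1\}^{W}$, $$T(p,q,y)=\mathbf{1}[y=pq].$$
   Context: Bit strings are identified with the nonnegative integers they represent in binary (e.g. $p=\sum_k 2^k p_k$), and $\mathbf{1}[\cdot]$ is $1$ if the condition holds and $0$ otherwise. A deterministic Boolean circuit is a finite acyclic network of gates connected by wires, each wire carrying a bit. Each gate $g$ with input wires $x=(x_1,\dots,x_a)$ and output wires $z=(z_1,\dots,z_b)$ computes a function $z=f_g(x)$, $f_g:\{0,1\}^a\to\{0,1\}^b$. Every wire is either a circuit input wire (a bit of $p$ or of $q$) or an output wire of exactly one gate. The bits of the output register $y$ are carried by $W$ distinct designated wires, each of which is an output wire of a gate. The input wires and the output-register wires are the external wires; all other wires are internal. The indicator tensor of a gate $g$ has one index for each input and output wire of $g$, and its entries are $A_g(x,z)=\mathbf{1}[z=f_g(x)]$. Contracting all internal wire indices means: for fixed values of the external wires, $T(p,q,y)$ is the sum, over all assignments of bits to the internal wires, of the product over all gates $g$ of the entry of $A_g$ selected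 by the values of the wires incident to $g$ (a wire has the same value at every gate it is attached to). *)

theory Defs
  imports Complex_Main "HOL-Library.FuncSet"
begin

text \<open>Bit strings are least significant bit first.\<close>

abbreviation bits_val :: "bool list \<Rightarrow> nat" where
  "bits_val bs \<equiv> horner_sum of_bool 2 bs"

record ('g, 'w) circuit =
  gates :: "'g set"
  wires :: "'w set"
  gate_ins :: "'g \<Rightarrow> 'w list"
  gate_outs :: "'g \<Rightarrow> 'w list"
  gate_fun :: "'g \<Rightarrow> bool list \<Rightarrow> bool list"
  p_reg :: "'w list"
  q_reg :: "'w list"
  y_reg :: "'w list"

definition feeds :: "('g, 'w, 'z) circuit_scheme \<Rightarrow> ('g \<times> 'g) set" where
  "feeds C = {(g, h). g \<in> gates C \<and> h \<in> gates C \<and> set (gate_outs C g) \<inter> set (gate_ins C h) \<noteq> {}}"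

text \<open>One wire may be attached to several inputs, also of the same gate, and a wire of the
  output register may in addition be an input of further gates.\<close>

definition boolean_circuit :: "('g, 'w, 'z) circuit_scheme \<Rightarrow> bool" where
  "boolean_circuit C \<longleftrightarrow>
     finite (gates C) \<and> finite (wires C) \<and> acyclic (feeds C) \<and>
     (\<forall>g\<in>gates C.
        set (gate_ins C g) \<subseteq> wires C \<and> set (gate_outs C g) \<subseteq> wires C \<and>
        distinct (gate_outs C g) \<and>
        (\<forall>x. length x = length (gate_ins C g) \<longrightarrow>
             length (gate_fun C g x) = length (gate_outs C g))) \<and>
     set (p_reg C @ q_reg C) \<subseteq> wires C \<and> distinct (p_reg C @ q_reg C) \<and>
     (\<forall>w\<in>wires C.
        if w \<in> set (p_reg C @ q_reg C) then \<not> (\<exists>g\<in>gates C. w \<in> set (gate_outs C g))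
        else (\<exists>!g. g \<in> gates C \<and> w \<in> set (gate_outs C g))) \<and>
     distinct (y_reg C) \<and> (\<forall>w\<in>set (y_reg C). \<exists>g\<in>gates C. w \<in> set (gate_outs C g))"

text \<open>Evaluation of the circuit: \<open>carries C p q w b\<close> states that, on input \<open>(p, q)\<close>, propagating
  bits through the gates puts the bit \<open>b\<close> on the wire \<open>w\<close>.\<close>

inductive carries ::
    "('g, 'w, 'z) circuit_scheme \<Rightarrow> bool list \<Rightarrow> bool list \<Rightarrow> 'w \<Rightarrow> bool \<Rightarrow> bool"
  for C p q where
  p_wire: "k < length (p_reg C) \<Longrightarrow> carries C p q (p_reg C ! k) (p ! k)"
| q_wire: "k < length (q_reg C) \<Longrightarrow> carries C p q (q_reg C ! k) (q ! k)"
| gate_wire: "g \<in> gates C \<Longrightarrow> list_all2 (carries C p q) (gate_ins C g) x \<Longrightarrow>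
    k < length (gate_outs C g) \<Longrightarrow> carries C p q (gate_outs C g ! k) (gate_fun C g x ! k)"

definition computes_product :: "('g, 'w, 'z) circuit_scheme \<Rightarrow> bool" where
  "computes_product C \<longleftrightarrow>
     (\<forall>p q. length p = length (p_reg C) \<longrightarrow> length q = length (q_reg C) \<longrightarrow>
        (\<exists>y. list_all2 (carries C p q) (y_reg C) y \<and> bits_val y = bits_val p * bits_val q))"

definition external_wires :: "('g, 'w, 'z) circuit_scheme \<Rightarrow> 'w list" where
  "external_wires C = p_reg C @ q_reg C @ y_reg C"

definition internal_wires :: "('g, 'w, 'z) circuit_scheme \<Rightarrow> 'w set" where
  "internal_wires C = wires C - set (external_wires C)"

text \<open>Tensor entries may lie in any commutative semiring, such as the real or complex numbers.\<close>

definition gate_tensor ::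
    "('g, 'w, 'z) circuit_scheme \<Rightarrow> 'g \<Rightarrow> bool list \<Rightarrow> bool list \<Rightarrow> 'k::comm_semiring_1" where
  "gate_tensor C g x z = of_bool (z = gate_fun C g x)"

definition wire_values ::
    "('g, 'w, 'z) circuit_scheme \<Rightarrow> bool list \<Rightarrow> bool list \<Rightarrow> bool list \<Rightarrow> ('w \<Rightarrow> bool) \<Rightarrow> 'w \<Rightarrow> bool"
  where
  "wire_values C p q y \<tau> w =
     (if w \<in> internal_wires C then \<tau> w
      else the (map_of (zip (external_wires C) (p @ q @ y)) w))"

definition contracted_tensor ::
    "('g, 'w, 'z) circuit_scheme \<Rightarrow> bool list \<Rightarrow> bool list \<Rightarrow> bool list \<Rightarrow> 'k::comm_semiring_1" where
  "contracted_tensor C p q y =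
     (\<Sum>\<tau> \<in> internal_wires C \<rightarrow>\<^sub>E (UNIV :: bool set).
        \<Prod>g\<in>gates C.
          gate_tensor C g (map (wire_values C p q y \<tau>) (gate_ins C g))
                          (map (wire_values C p q y \<tau>) (gate_outs C g)))"

end

theory Submission imports Defs
begin

text \<open>A product of gate indicators is the indicator that every gate relation holds, so the
  contraction counts the assignments of bits to the internal wires that satisfy all gates, given
  the prescribed bits on the external wires. An assignment that satisfies all gates and carries
  \<open>p\<close> and \<open>q\<close> on the input wires has no freedom left: following the propagation of bits through
  the gates, it agrees with the evaluation of the circuit on every wire that evaluation reaches
  (\<open>carries_imp_satisfying_value\<close>), and because the circuit is acyclic evaluation reaches every
  wire (\<open>carries_total\<close>). Conversely, evaluation itself satisfies all gates, because every wire
  has a single driver and so receives only one bit (\<open>carries_unique\<close>, \<open>evaluation_satisfies\<close>).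

  Hence the count is one if \<open>y\<close> is the output that the circuit evaluates to, and zero otherwise.
  This holds for every circuit (\<open>contracted_tensor_eq_indicator\<close>). For a multiplier the output is
  the only string of its length that represents \<open>pq\<close>.\<close>

section \<open>Evaluation of a circuit\<close>

lemma gate_wires:
  assumes "boolean_circuit C" "g \<in> gates C"
  shows "set (gate_ins C g) \<subseteq> wires C" "set (gate_outs C g) \<subseteq> wires C"
  using assms by (simp_all add: boolean_circuit_def)

lemma wire_driver:
  assumes "boolean_circuit C" "w \<in> wires C"
  shows "if w \<in> set (p_reg C @ q_reg C) then \<not> (\<exists>g\<in>gates C. w \<in> set (gate_outs C g))
         else (\<exists>!g. g \<in> gates C \<and> w \<in> set (gate_outs C g))"
  using assms unfolding boolean_circuit_def by (elim conjE) (erule (1) bspec)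

lemma gate_output_not_input:
  assumes "boolean_circuit C" "g \<in> gates C" "w \<in> set (gate_outs C g)"
  shows "w \<notin> set (p_reg C)" "w \<notin> set (q_reg C)"
proof -
  have "w \<in> wires C"
    using gate_wires(2)[OF assms(1,2)] assms(3) by blast
  from wire_driver[OF assms(1) this] have "w \<notin> set (p_reg C @ q_reg C)"
    using assms(2,3) by metis
  then show "w \<notin> set (p_reg C)" "w \<notin> set (q_reg C)"
    by auto
qed

lemma single_driver:
  assumes "boolean_circuit C" "g \<in> gates C" "h \<in> gates C"
    and "w \<in> set (gate_outs C g)" "w \<in> set (gate_outs C h)"
  shows "g = h"
proof -
  have "w \<in> wires C"
    using gate_wires(2)[OF assms(1,2)] assms(4) by blast
  from wire_driver[OF assms(1) this] have "\<exists>!g. g \<in> gates C \<and> w \<in> set (gate_outs C g)"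
    using gate_output_not_input[OF assms(1,2,4)] by simp
  then show ?thesis
    using assms(2-5) by blast
qed

lemma external_wires_subset:
  assumes "boolean_circuit C"
  shows "set (external_wires C) \<subseteq> wires C"
proof -
  have "set (p_reg C @ q_reg C) \<subseteq> wires C" "\<forall>w\<in>set (y_reg C). \<exists>g\<in>gates C. w \<in> set (gate_outs C g)"
    using assms by (simp_all add: boolean_circuit_def)
  then show ?thesis
    using gate_wires(2)[OF assms] by (fastforce simp: external_wires_def)
qed

text \<open>Each of the three rules for \<^const>\<open>carries\<close> excludes the other two on the same wire, since a
  wire is either one bit of one input register or one output position of one gate. Two
  derivations for a wire therefore end with the same gate, and by induction that gate was given
  the same inputs.\<close>

lemma carries_unique:
  assumes C: "boolean_circuit C"
    and "carries C p q w b" "carries C p q w b'"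
  shows "b = b'"
  using assms(2,3)
proof (induction arbitrary: b' rule: carries.induct)
  case (p_wire k)
  from p_wire.prems show ?case
  proof cases
    case (p_wire j)
    then show ?thesis
      using C \<open>k < length (p_reg C)\<close> by (auto simp: boolean_circuit_def nth_eq_iff_index_eq)
  next
    case (q_wire j)
    then have "p_reg C ! k \<in> set (p_reg C) \<inter> set (q_reg C)"
      using \<open>k < length (p_reg C)\<close> by (metis IntI nth_mem)
    then show ?thesis
      using C by (auto simp: boolean_circuit_def)
  next
    case (gate_wire g x j)
    then show ?thesis
      using gate_output_not_input(1)[OF C] \<open>k < length (p_reg C)\<close> by (metis nth_mem)
  qed
next
  case (q_wire k)
  from q_wire.prems show ?case
  proof cases
    case (p_wire j)
    then have "q_reg C ! k \<in> set (p_reg C) \<inter> set (q_reg C)"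
      using \<open>k < length (q_reg C)\<close> by (metis IntI nth_mem)
    then show ?thesis
      using C by (auto simp: boolean_circuit_def)
  next
    case (q_wire j)
    then show ?thesis
      using C \<open>k < length (q_reg C)\<close> by (auto simp: boolean_circuit_def nth_eq_iff_index_eq)
  next
    case (gate_wire g x j)
    then show ?thesis
      using gate_output_not_input(2)[OF C] \<open>k < length (q_reg C)\<close> by (metis nth_mem)
  qed
next
  case (gate_wire g x k)
  have out: "gate_outs C g ! k \<in> set (gate_outs C g)"
    using gate_wire.hyps by simp
  have ins: "length (gate_ins C g) = length x"
    and IH: "\<And>i b'. \<lbrakk>i < length x; carries C p q (gate_ins C g ! i) b'\<rbrakk> \<Longrightarrow> x ! i = b'"
    using gate_wire.IH by (simp_all add: list_all2_conv_all_nth)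
  from gate_wire.prems show ?case
  proof cases
    case (p_wire j)
    then show ?thesis
      using gate_output_not_input(1)[OF C gate_wire.hyps(1) out] by (metis nth_mem)
  next
    case (q_wire j)
    then show ?thesis
      using gate_output_not_input(2)[OF C gate_wire.hyps(1) out] by (metis nth_mem)
  next
    case (gate_wire h x' j)
    then have "g = h"
      using single_driver[OF C \<open>g \<in> gates C\<close> _ out] by (metis nth_mem)
    moreover have "distinct (gate_outs C g)"
      using C \<open>g \<in> gates C\<close> by (auto simp: boolean_circuit_def)
    ultimately have "j = k"
      using gate_wire \<open>k < length (gate_outs C g)\<close> by (simp add: nth_eq_iff_index_eq)
    moreover have "x = x'"
    proof (rule nth_equalityI)
      have x': "list_all2 (carries C p q) (gate_ins C g) x'"
        using gate_wire(4) \<open>g = h\<close> by simp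
      then show "length x = length x'"
        using ins list_all2_lengthD by fastforce
      show "x ! i = x' ! i" if "i < length x" for i
        using IH[OF that list_all2_nthD[OF x']] ins that by simp
    qed
    ultimately show ?thesis
      using gate_wire \<open>g = h\<close> by simp
  qed
qed

text \<open>Finitely many gates without a cycle make the relation \<^const>\<open>feeds\<close> well-founded, so bits
  can be propagated gate by gate, each gate after all gates that drive its inputs.\<close>

lemma carries_total:
  assumes C: "boolean_circuit C" and "w \<in> wires C"
  shows "\<exists>b. carries C p q w b"
proof -
  have input: "\<exists>b. carries C p q w b" if "w \<in> set (p_reg C @ q_reg C)" for w
    using that by (auto simp: in_set_conv_nth intro: carries.p_wire carries.q_wire)
  have driven: "\<exists>g\<in>gates C. w \<in> set (gate_outs C g)"
    if "w \<in> wires C" "w \<notin> set (p_reg C @ q_reg C)" for w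
    using wire_driver[OF C that(1)] that(2) by auto
  have "finite (feeds C)"
    by (rule finite_subset[of _ "gates C \<times> gates C"])
      (use C in \<open>auto simp: feeds_def boolean_circuit_def\<close>)
  then have wf: "wf (feeds C)"
    using C by (simp add: finite_acyclic_wf boolean_circuit_def)
  have outs: "\<forall>w\<in>set (gate_outs C g). \<exists>b. carries C p q w b" if "g \<in> gates C" for g
    using wf that
  proof (induction g rule: wf_induct_rule)
    case (less g)
    have "\<exists>b. carries C p q w b" if w: "w \<in> set (gate_ins C g)" for w
    proof (cases "w \<in> set (p_reg C @ q_reg C)")
      case True
      then show ?thesis by (rule input)
    next
      case False
      moreover have "w \<in> wires C"
        using gate_wires(1)[OF C less.prems] w by blast
      ultimately obtain h where "h \<in> gates C" "w \<in> set (gate_outs C h)"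
        using driven by blast
      moreover from this have "(h, g) \<in> feeds C"
        using w less.prems by (auto simp: feeds_def)
      ultimately show ?thesis
        using less.IH by blast
    qed
    then obtain v where "\<forall>w\<in>set (gate_ins C g). carries C p q w (v w)"
      by metis
    then have "list_all2 (carries C p q) (gate_ins C g) (map v (gate_ins C g))"
      by (simp add: list_all2_conv_all_nth)
    then show ?case
      using carries.gate_wire[OF less.prems] by (metis in_set_conv_nth)
  qed
  show ?thesis
    using input driven outs \<open>w \<in> wires C\<close> by blast
qed

section \<open>Assignments that satisfy all gates\<close>

definition satisfies_gates :: "('g, 'w, 'z) circuit_scheme \<Rightarrow> ('w \<Rightarrow> bool) \<Rightarrow> bool" where
  "satisfies_gates C v \<longleftrightarrow>
     (\<forall>g\<in>gates C. map v (gate_outs C g) = gate_fun C g (map v (gate_ins C g)))"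

lemma satisfies_gates_cong:
  assumes "boolean_circuit C" and "\<And>w. w \<in> wires C \<Longrightarrow> v w = v' w"
  shows "satisfies_gates C v \<longleftrightarrow> satisfies_gates C v'"
proof -
  have "map v (gate_outs C g) = map v' (gate_outs C g)"
       "map v (gate_ins C g) = map v' (gate_ins C g)" if "g \<in> gates C" for g
    using assms(2) gate_wires[OF assms(1) that] by (auto simp: subset_iff)
  then show ?thesis
    unfolding satisfies_gates_def by (intro ball_cong refl) (simp only:)
qed

text \<open>Satisfying a gate forces its outputs once its inputs are forced, so the derivation of
  \<^const>\<open>carries\<close> can be followed step by step.\<close>

lemma carries_imp_satisfying_value:
  assumes "satisfies_gates C v" "map v (p_reg C) = p" "map v (q_reg C) = q"
    and "carries C p q w b"
  shows "v w = b"
  using assms(4)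
proof (induction rule: carries.induct)
  case (gate_wire g x k)
  then have "x = map v (gate_ins C g)"
    by (auto simp: list_all2_conv_all_nth intro!: nth_equalityI)
  then have "gate_fun C g x ! k = map v (gate_outs C g) ! k"
    using assms(1) gate_wire.hyps by (simp add: satisfies_gates_def)
  then show ?case
    using gate_wire.hyps by simp
qed (use assms in auto)

lemma evaluation_satisfies:
  assumes C: "boolean_circuit C" and v: "\<And>w. w \<in> wires C \<Longrightarrow> carries C p q w (v w)"
  shows "satisfies_gates C v"
  unfolding satisfies_gates_def
proof
  fix g assume g: "g \<in> gates C"
  then have ins: "set (gate_ins C g) \<subseteq> wires C" and outs: "set (gate_outs C g) \<subseteq> wires C"
    and len: "length (gate_fun C g (map v (gate_ins C g))) = length (gate_outs C g)"
    using gate_wires[OF C g] C g by (simp_all add: boolean_circuit_def)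
  have "list_all2 (carries C p q) (gate_ins C g) (map v (gate_ins C g))"
    using ins v by (auto simp: list_all2_conv_all_nth subset_iff)
  then have "carries C p q (gate_outs C g ! k) (gate_fun C g (map v (gate_ins C g)) ! k)"
    if "k < length (gate_outs C g)" for k
    using that by (rule carries.gate_wire[OF g])
  moreover have "carries C p q (gate_outs C g ! k) (v (gate_outs C g ! k))"
    if "k < length (gate_outs C g)" for k
    using outs v that by (meson nth_mem subsetD)
  ultimately have "gate_fun C g (map v (gate_ins C g)) ! k = v (gate_outs C g ! k)"
    if "k < length (gate_outs C g)" for k
    using carries_unique[OF C] that by blast
  then show "map v (gate_outs C g) = gate_fun C g (map v (gate_ins C g))"
    using len by (intro nth_equalityI) simp_all
qed

section \<open>The contracted tensor\<close>

lemma prod_gate_tensor: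
  assumes "finite (gates C)"
  shows "(\<Prod>g\<in>gates C. gate_tensor C g (map v (gate_ins C g)) (map v (gate_outs C g)))
       = (of_bool (satisfies_gates C v) :: 'k::comm_semiring_1)"
proof -
  have "(\<Prod>g\<in>G. of_bool (P g)) = (of_bool (\<forall>g\<in>G. P g) :: 'k)" if "finite G" for G and P :: "'a \<Rightarrow> bool"
    using that by induction auto
  then show ?thesis
    using assms by (simp add: gate_tensor_def satisfies_gates_def)
qed

text \<open>Looking up a bit by its wire recovers the given registers because no wire occurs twice
  among the external wires: input wires are not driven, whereas output-register wires are.\<close>

lemma map_wire_values_registers:
  assumes C: "boolean_circuit C"
    and len: "length p = length (p_reg C)" "length q = length (q_reg C)" "length y = length (y_reg C)"
  shows "map (wire_values C p q y \<tau>) (p_reg C) = p"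
    and "map (wire_values C p q y \<tau>) (q_reg C) = q"
    and "map (wire_values C p q y \<tau>) (y_reg C) = y"
proof -
  have "set (p_reg C @ q_reg C) \<inter> set (y_reg C) = {}"
    using C gate_output_not_input[OF C] by (fastforce simp: boolean_circuit_def)
  then have dist: "distinct (external_wires C)"
    using C by (auto simp: boolean_circuit_def external_wires_def)
  have len': "length (external_wires C) = length (p @ q @ y)"
    using len by (simp add: external_wires_def)
  have "wire_values C p q y \<tau> (external_wires C ! k) = (p @ q @ y) ! k"
    if k: "k < length (external_wires C)" for k
  proof -
    have "external_wires C ! k \<notin> internal_wires C"
      using k by (simp add: internal_wires_def)
    then show ?thesis
      using k dist len' by (simp add: wire_values_def map_of_zip_nth)
  qed
  then have "map (wire_values C p q y \<tau>) (external_wires C) = p @ q @ y"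
    using len' by (auto intro!: nth_equalityI)
  then have "map (wire_values C p q y \<tau>) (p_reg C) = p
      \<and> map (wire_values C p q y \<tau>) (q_reg C) = q \<and> map (wire_values C p q y \<tau>) (y_reg C) = y"
    using len by (simp add: external_wires_def)
  then show "map (wire_values C p q y \<tau>) (p_reg C) = p"
    and "map (wire_values C p q y \<tau>) (q_reg C) = q"
    and "map (wire_values C p q y \<tau>) (y_reg C) = y"
    by auto
qed

text \<open>Among the assignments to the internal wires only the one read off from evaluation can
  satisfy all gates, and it does so together with the prescribed external bits exactly if \<open>y\<close> is
  the evaluated output.\<close>

theorem contracted_tensor_eq_indicator:
  assumes C: "boolean_circuit C"
    and len: "length p = length (p_reg C)" "length q = length (q_reg C)" "length y = length (y_reg C)"
  shows "contracted_tensor C p q y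
       = (of_bool (list_all2 (carries C p q) (y_reg C) y) :: 'k::comm_semiring_1)"
proof -
  let ?I = "internal_wires C" and ?V = "wire_values C p q y"
  note regs = map_wire_values_registers[OF C len]
  obtain e where e: "\<And>w. w \<in> wires C \<Longrightarrow> carries C p q w (e w)"
    using carries_total[OF C, of _ p q] by metis
  have I: "?I \<subseteq> wires C" "finite ?I"
    using C by (auto simp: internal_wires_def boolean_circuit_def)
  note ext = external_wires_subset[OF C]
  define out where "out \<longleftrightarrow> list_all2 (carries C p q) (y_reg C) y"
  have out_iff: "out \<longleftrightarrow> map e (y_reg C) = y"
  proof -
    have "carries C p q (y_reg C ! k) b \<longleftrightarrow> e (y_reg C ! k) = b" if "k < length (y_reg C)" for k b
    proof -
      have "y_reg C ! k \<in> wires C"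
        using ext that by (auto simp: external_wires_def)
      then show ?thesis
        using e carries_unique[OF C] by blast
    qed
    then show ?thesis
      using len by (auto simp: out_def list_all2_conv_all_nth list_eq_iff_nth_eq)
  qed
  have key: "satisfies_gates C (?V \<tau>) \<longleftrightarrow> out \<and> \<tau> = restrict e ?I"
    if \<tau>: "\<tau> \<in> ?I \<rightarrow>\<^sub>E UNIV" for \<tau>
  proof
    assume sat: "satisfies_gates C (?V \<tau>)"
    have agree: "?V \<tau> w = e w" if "w \<in> wires C" for w
      using carries_imp_satisfying_value[OF sat regs(1,2) e[OF that]] .
    have "map e (y_reg C) = map (?V \<tau>) (y_reg C)"
      using agree ext by (auto simp: external_wires_def)
    then have "out"
      using out_iff regs(3) by simp
    moreover have "\<tau> = restrict e ?I"
    proof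
      fix w
      show "\<tau> w = restrict e ?I w"
      proof (cases "w \<in> ?I")
        case True
        then have "?V \<tau> w = e w"
          using agree I(1) by blast
        then show ?thesis
          using True by (simp add: wire_values_def)
      next
        case False
        \<comment> \<open>outside \<open>?I\<close> both extensional functions take the same default value\<close>
        then show ?thesis
          using PiE_arb[OF \<tau>] by simp
      qed
    qed
    ultimately show "out \<and> \<tau> = restrict e ?I" ..
  next
    assume asm: "out \<and> \<tau> = restrict e ?I"
    have e_regs: "map e (p_reg C) = p" "map e (q_reg C) = q"
    proof -
      have p_wires: "set (p_reg C) \<subseteq> wires C" and q_wires: "set (q_reg C) \<subseteq> wires C"
        using ext by (auto simp: external_wires_def)
      have "e (p_reg C ! k) = p ! k" if "k < length (p_reg C)" for k
        by (rule carries_unique[OF C e carries.p_wire[OF that]])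
          (use p_wires that in \<open>auto simp: subset_iff\<close>)
      then show "map e (p_reg C) = p"
        using len by (auto intro!: nth_equalityI)
      have "e (q_reg C ! k) = q ! k" if "k < length (q_reg C)" for k
        by (rule carries_unique[OF C e carries.q_wire[OF that]])
          (use q_wires that in \<open>auto simp: subset_iff\<close>)
      then show "map e (q_reg C) = q"
        using len by (auto intro!: nth_equalityI)
    qed
    have "map (?V \<tau>) (external_wires C) = map e (external_wires C)"
      using regs e_regs asm out_iff by (simp add: external_wires_def)
    then have "?V \<tau> w = e w" if "w \<in> wires C" for w
      using that asm by (cases "w \<in> ?I") (auto simp: wire_values_def internal_wires_def)
    then show "satisfies_gates C (?V \<tau>)"
      using satisfies_gates_cong[OF C] evaluation_satisfies[OF C e] by blast
  qed
  have "contracted_tensor C p q y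
      = (\<Sum>\<tau> \<in> ?I \<rightarrow>\<^sub>E UNIV. of_bool (satisfies_gates C (?V \<tau>)) :: 'k)"
    using C by (simp add: contracted_tensor_def prod_gate_tensor boolean_circuit_def)
  also have "\<dots> = (\<Sum>\<tau> \<in> ?I \<rightarrow>\<^sub>E UNIV. if \<tau> = restrict e ?I then of_bool out else 0)"
    by (rule sum.cong) (auto simp: key)
  also have "\<dots> = of_bool out"
    using I(2) by (simp add: finite_PiE)
  finally show ?thesis
    unfolding out_def .
qed

section \<open>Multipliers\<close>

lemma bits_val_inject:
  assumes "length xs = length ys"
  shows "bits_val xs = bits_val ys \<longleftrightarrow> xs = ys"
  using assms
proof (induction xs ys rule: list_induct2)
  case (Cons x xs y ys)
  have "of_bool x + 2 * bits_val xs = of_bool y + 2 * bits_val ys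
      \<longleftrightarrow> x = y \<and> bits_val xs = bits_val ys"
    by (cases x; cases y) (simp_all, presburger+)
  then show ?case
    using Cons.IH by simp
qed simp

theorem theorem3p1:
  fixes C :: "('g, 'w) circuit" and n m W :: nat
  assumes "n \<ge> 1" and "m = nat \<lceil>real n / 2\<rceil>"
    and "boolean_circuit C"
    and "length (p_reg C) = n - 1" and "length (q_reg C) = m" and "length (y_reg C) = W"
    and "\<forall>p q. length p = n - 1 \<longrightarrow> length q = m \<longrightarrow> bits_val p * bits_val q < 2 ^ W"
    and "computes_product C"
  shows "\<forall>p q y. length p = n - 1 \<longrightarrow> length q = m \<longrightarrow> length y = W \<longrightarrow>
    (contracted_tensor C p q y :: 'k::comm_semiring_1) = of_bool (bits_val y = bits_val p * bits_val q)"
proof (intro allI impI)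
  fix p q y :: "bool list"
  assume len: "length p = n - 1" "length q = m" "length y = W"
  obtain y' where y': "list_all2 (carries C p q) (y_reg C) y'"
    and val: "bits_val y' = bits_val p * bits_val q"
    using assms(4,5,8) len unfolding computes_product_def by metis
  have len': "length y' = length y"
    using list_all2_lengthD[OF y'] assms(6) len by simp
  \<comment> \<open>each output wire receives only one bit, so evaluation yields no output other than \<open>y'\<close>\<close>
  have "y = y'" if y: "list_all2 (carries C p q) (y_reg C) y"
  proof (rule nth_equalityI)
    fix k assume "k < length y"
    then show "y ! k = y' ! k"
      using carries_unique[OF assms(3)] list_all2_nthD2[OF y, of k] list_all2_nthD2[OF y', of k] len'
      by metis
  qed (simp add: len')
  then have "list_all2 (carries C p q) (y_reg C) y \<longleftrightarrow> y = y'"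
    using y' by blast
  also have "\<dots> \<longleftrightarrow> bits_val y = bits_val p * bits_val q"
    using bits_val_inject[OF len'] val by auto
  finally show "(contracted_tensor C p q y :: 'k) = of_bool (bits_val y = bits_val p * bits_val q)"
    using contracted_tensor_eq_indicator[OF assms(3), of p q y] assms(4-6) len by simp
qed

end
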